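(* Let $k \geq 2$ be a natural number and let $\gamma > 1$ be a real number. Let $\Gamma = \Gamma_{k,\gamma}$ be the rooted tree with root $O$ defined in the context, with vertex set $\mathscr{V}(\Gamma)$ and graph distance $d$, and for $r>0$ let $B_\Gamma(r) = \{x \in \mathscr{V}(\Gamma) \mid d(x,O) \leq r\}$. Then $$\lim_{r\to\infty} \frac{\log \# B_\Gamma(r)}{\log r} = \frac{\log (\gamma k)}{\log \gamma} = 1 + \frac{\log k}{\log \gamma}.$$
   Context: A rooted tree is a tree graph with a distinguished vertex $O$ (the root). For vertices $x,y$ of a tree, $d(x,y)$ is the number of edges of the unique path of minimal length connecting them. A vertex $y$ is a forward neighbor of $x$ if $d(x,y)=1$ and $d(y,O)>d(x,O)$. For a real number $t$, $[t]$ denotes its integer part. For a finite set $A$, $\#A$ denotes its number of elements. Definition of $\Gamma_{k,\gamma}$ (for a natural number $k\ge 2$ and a real number $\gamma \ge 1$): it is the rooted tree in which the root $O$, and every vertex whose distance from $O$ equals $\sum_{j=1}^N [\gamma^j]$ for some $N \in \mathbb{N}$, $N\ge 1$, have exactly $k$ forward neighbors, while every other vertex has exactly one forward neighbor. *)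

theory Defs
  imports Complex_Main "Graph_Theory.Graph_Theory"
begin

text \<open>
  Undirected simple graphs are represented, as in the entry Graph_Theory, by symmetric loopfree
  sets of pairs (\<^locale>\<open>pair_bidirected_digraph\<close>): an edge between \<open>u\<close> and \<open>v\<close> is present as both arcs
  \<open>(u, v)\<close> and \<open>(v, u)\<close>. The graphs may be infinite.
\<close>

definition (in pre_digraph) gdist :: "'a \<Rightarrow> 'a \<Rightarrow> nat" where
  "gdist x y = (LEAST n. \<exists>p. apath x p y \<and> length p = n)"

definition (in pre_digraph) gball :: "'a \<Rightarrow> real \<Rightarrow> 'a set" where
  "gball c r = {x \<in> verts G. real (gdist x c) \<le> r}"

text \<open>
  The predicate \<^const>\<open>tree\<close> of Graph_Theory cannot be used here: in a symmetric digraph every edge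
  gives a directed cycle \<open>u, v, u\<close> of length 2. The cycles of the undirected graph are exactly the
  directed ones of length at least 3.
\<close>

locale rooted_tree = pair_bidirected_digraph G for G :: "'a pair_pre_digraph" +
  fixes rt :: 'a
  assumes root_in_verts: "rt \<in> pverts G"
    and connected: "Digraph_Component.connected (with_proj G)"
    and acyclic: "\<not> (\<exists>p. cycle p \<and> length p \<ge> 3)"
begin

definition forward_neighbors :: "'a \<Rightarrow> 'a set" where
  "forward_neighbors x = {y \<in> pverts G. gdist x y = 1 \<and> gdist y rt > gdist x rt}"

end

definition branching_radii :: "real \<Rightarrow> nat set" where
  "branching_radii \<gamma> = {\<Sum>j=1..N. nat \<lfloor>\<gamma> ^ j\<rfloor> | N. N \<ge> 1}"

text \<open>
  The tree $\Gamma_{k,\gamma}$ is only determined up to isomorphism; the locale characterises its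
  isomorphism class.
\<close>

locale Gamma_tree = rooted_tree G rt
  for k :: nat and \<gamma> :: real and G :: "'a pair_pre_digraph" and rt :: 'a +
  assumes k_ge_2: "k \<ge> 2"
    and \<gamma>_ge_1: "\<gamma> \<ge> 1"
    and card_forward_neighbors_branching: "\<And>x. x \<in> pverts G \<Longrightarrow>
      x = rt \<or> gdist x rt \<in> branching_radii \<gamma> \<Longrightarrow> card (forward_neighbors x) = k"
    and card_forward_neighbors_other: "\<And>x. x \<in> pverts G \<Longrightarrow>
      \<not> (x = rt \<or> gdist x rt \<in> branching_radii \<gamma>) \<Longrightarrow> card (forward_neighbors x) = 1"

text \<open>
  The locale \<^locale>\<open>Gamma_tree\<close> is inhabited. In the model the vertices are lists, the parent of
  \<open>a # xs\<close> is \<open>xs\<close>, and every vertex of length \<open>n\<close> has \<open>c n\<close> children.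
\<close>

primrec lt_valid :: "(nat \<Rightarrow> nat) \<Rightarrow> nat list \<Rightarrow> bool" where
  "lt_valid c [] = True"
| "lt_valid c (a # xs) = (a < c (length xs) \<and> lt_valid c xs)"

definition list_tree :: "(nat \<Rightarrow> nat) \<Rightarrow> nat list pair_pre_digraph" where
  "list_tree c = \<lparr>pverts = {xs. lt_valid c xs},
     parcs = {(u, v). lt_valid c u \<and> lt_valid c v \<and> (\<exists>a. u = a # v \<or> v = a # u)}\<rparr>"

lemma pverts_lt [simp]: "pverts (list_tree c) = {xs. lt_valid c xs}"
  by (simp add: list_tree_def)

lemma parcs_lt [simp]: "parcs (list_tree c) = {(u, v). lt_valid c u \<and> lt_valid c v \<and> (\<exists>a. u = a # v \<or> v = a # u)}"
  by (simp add: list_tree_def)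

primrec lt_down :: "nat list \<Rightarrow> (nat list \<times> nat list) list" where
  "lt_down [] = []"
| "lt_down (a # xs) = (a # xs, xs) # lt_down xs"

lemma length_lt_down: "length (lt_down xs) = length xs"
  by (induction xs) auto

lemma lt_pcas_nth:
  "pcas u p v \<Longrightarrow> Suc i < length p \<Longrightarrow> snd (p ! i) = fst (p ! Suc i)"
proof (induction u p v arbitrary: i rule: pcas.induct)
  case (2 u e es v)
  show ?case
  proof (cases i)
    case 0
    with 2 show ?thesis by (cases es) auto
  next
    case (Suc j)
    with 2 show ?thesis by auto
  qed
qed auto

lemma lt_pcas_ends:
  "pcas u p v \<Longrightarrow> p \<noteq> [] \<Longrightarrow> fst (p ! 0) = u \<and> snd (p ! (length p - 1)) = v"
proof (induction u p v rule: pcas.induct)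
  case (2 u e es v)
  then show ?case by (cases es) auto
qed auto

lemma lt_tl_pawalk_verts: "pcas u p v \<Longrightarrow> tl (pawalk_verts u p) = map snd p"
proof (induction u p v rule: pcas.induct)
  case (2 u e es v)
  then show ?case by (cases es) auto
qed auto

lemma lt_bidir: "pair_bidirected_digraph (list_tree c)"
  by unfold_locales (auto simp: list_tree_def symmetric_def sym_def)

lemma list_tree_acyclic:
  assumes "pre_digraph.cycle (with_proj (list_tree c)) p" "length p \<ge> 3"
  shows False
proof -
  interpret pair_bidirected_digraph "list_tree c" by (rule lt_bidir)
  let ?n = "length p"
  from assms obtain u where u: "awalk u p u" "distinct (tl (pawalk_verts u p))" "p \<noteq> []"
    unfolding cycle_def by auto
  have cas: "pcas u p u" and sub: "set p \<subseteq> parcs (list_tree c)" using u(1) by (auto simp: awalk_def)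
  have dist: "distinct (map snd p)" using u(2) lt_tl_pawalk_verts[OF cas] by simp
  define m where "m = Max (length ` snd ` set p)"
  have "m \<in> length ` snd ` set p" unfolding m_def using u(3) by (intro Max_in) auto
  then obtain j where j: "j < ?n" "length (snd (p ! j)) = m" by (auto simp: in_set_conv_nth)
  have le: "length (snd (p ! i)) \<le> m" if "i < ?n" for i
    unfolding m_def using that by (intro Max_ge) auto
  define jp where "jp = (if j = 0 then ?n - 1 else j - 1)"
  define jn where "jn = (if j = ?n - 1 then 0 else j + 1)"
  have lt: "jp < ?n" "jn < ?n" "jp \<noteq> jn" using j assms(2) by (auto simp: jp_def jn_def)
  have ends: "fst (p ! 0) = u" "snd (p ! (?n - 1)) = u" using lt_pcas_ends[OF cas u(3)] by auto
  have 1: "snd (p ! jp) = fst (p ! j)"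
    using ends lt_pcas_nth[OF cas, of "j - 1"] j by (auto simp: jp_def)
  have 2: "snd (p ! j) = fst (p ! jn)"
    using ends lt_pcas_nth[OF cas, of "j"] j by (auto simp: jn_def)
  have arcs: "p ! j \<in> parcs (list_tree c)" "p ! jn \<in> parcs (list_tree c)"
    using sub j(1) lt(2) nth_mem by blast+
  have "snd (p ! jp) = tl (snd (p ! j))"
    using arcs(1) 1 le[OF lt(1)] j(2) by auto
  moreover have "snd (p ! jn) = tl (snd (p ! j))"
    using arcs(2) 2 le[OF lt(2)] j(2) by auto
  ultimately show False
    using dist lt unfolding distinct_conv_nth by (metis length_map nth_map)
qed

lemma lt_down_apath:
  assumes "lt_valid c xs"
  shows "pre_digraph.apath (with_proj (list_tree c)) xs (lt_down xs) []"
proof -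
  interpret pair_bidirected_digraph "list_tree c" by (rule lt_bidir)
  have *: "\<forall>v \<in> set (pawalk_verts xs (lt_down xs)). length v \<le> length xs" for xs :: "nat list"
    by (induction xs) auto
  have "distinct (pawalk_verts xs (lt_down xs))"
  proof (induction xs)
    case (Cons a xs)
    then show ?case using *[of xs] by auto
  qed auto
  moreover have "awalk xs (lt_down xs) []"
    using assms by (induction xs) (auto simp: awalk_def)
  ultimately show ?thesis by (simp add: apath_def)
qed

lemma lt_awalk_length:
  assumes "pre_digraph.awalk (with_proj (list_tree c)) u p v"
  shows "length u \<le> length v + length p"
proof -
  interpret pair_bidirected_digraph "list_tree c" by (rule lt_bidir)
  from assms show ?thesis
  proof (induction p arbitrary: u)
    case (Cons e p)
    then have e: "e \<in> parcs (list_tree c)" "u = fst e" "awalk (snd e) p v"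
      by (auto simp: awalk_Cons_iff)
    have "length (fst e) \<le> Suc (length (snd e))" using e(1) by auto
    with Cons.IH[OF e(3)] e(2) show ?case by simp
  qed (auto simp: awalk_def)
qed

lemma gdist_list_tree:
  assumes "lt_valid c xs"
  shows "pre_digraph.gdist (with_proj (list_tree c)) xs [] = length xs"
proof -
  interpret pair_bidirected_digraph "list_tree c" by (rule lt_bidir)
  show ?thesis unfolding gdist_def
  proof (rule Least_equality)
    show "\<exists>p. apath xs p [] \<and> length p = length xs"
      using lt_down_apath[OF assms] length_lt_down by blast
    fix n assume "\<exists>p. apath xs p [] \<and> length p = n"
    then obtain p where p: "awalk xs p []" "length p = n" unfolding apath_def by blast
    show "length xs \<le> n" using lt_awalk_length[OF p(1)] p(2) by simp
  qed
qed

lemma list_tree_reach: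
  assumes "lt_valid c x" "lt_valid c y"
  shows "\<exists>p. pre_digraph.apath (with_proj (list_tree c)) x p y"
proof -
  interpret pair_bidirected_digraph "list_tree c" by (rule lt_bidir)
  have r: "x \<rightarrow>\<^sup>*\<^bsub>with_proj (list_tree c)\<^esub> []" if "lt_valid c x" for x
    using lt_down_apath[OF that] reachable_apath by blast
  have "[] \<rightarrow>\<^sup>*\<^bsub>with_proj (list_tree c)\<^esub> y" using r[OF assms(2)] by (rule symmetric_reachable[OF sym_arcs])
  with r[OF assms(1)] have "x \<rightarrow>\<^sup>*\<^bsub>with_proj (list_tree c)\<^esub> y" using reachable_trans by blast
  then show ?thesis using reachable_apath by blast
qed

lemma lt_rooted: "rooted_tree (list_tree c) []"
proof -
  interpret pair_bidirected_digraph "list_tree c" by (rule lt_bidir)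
  show ?thesis
  proof unfold_locales
    show "[] \<in> pverts (list_tree c)" by simp
    have "x \<rightarrow>\<^sup>*\<^bsub>with_proj (list_tree c)\<^esub> y" if "lt_valid c x" "lt_valid c y" for x y
      using list_tree_reach[OF that] reachable_apath by blast
    then have "strongly_connected (with_proj (list_tree c))"
      unfolding strongly_connected_def by (auto intro: exI[of _ "[]"])
    then show "Digraph_Component.connected (with_proj (list_tree c))"
      using reachable_mk_symmetric_eq[OF sym_arcs]
      unfolding Digraph_Component.connected_def strongly_connected_def by simp
    show "\<not> (\<exists>p. cycle p \<and> length p \<ge> 3)" using list_tree_acyclic by blast
  qed
qed

lemma lt_gdist_eq_1:
  assumes "lt_valid c x" "lt_valid c y"
  shows "pre_digraph.gdist (with_proj (list_tree c)) x y = 1 \<longleftrightarrow> (\<exists>a. x = a # y \<or> y = a # x)"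
proof -
  interpret pair_bidirected_digraph "list_tree c" by (rule lt_bidir)
  let ?P = "\<lambda>n. \<exists>p. apath x p y \<and> length p = n"
  have ex: "\<exists>n. ?P n" using list_tree_reach[OF assms] by blast
  show ?thesis
  proof
    assume "gdist x y = 1"
    then have "?P 1" using LeastI_ex[OF ex] by (simp add: gdist_def)
    then obtain p where "apath x p y" "length p = 1" by blast
    then show "\<exists>a. x = a # y \<or> y = a # x"
      by (cases p) (auto simp: apath_def awalk_def)
  next
    assume a: "\<exists>a. x = a # y \<or> y = a # x"
    have "?P 1" using a assms
      by (intro exI[of _ "[(x,y)]"]) (auto simp: apath_def awalk_def)
    moreover have "\<not> ?P 0" using a by (auto simp: apath_def awalk_def)
    ultimately show "gdist x y = 1" unfolding gdist_def
      by (intro Least_equality) (auto simp: Suc_le_eq intro!: gr0I)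
  qed
qed

lemma lt_card_forward_neighbors:
  assumes "lt_valid c x"
  shows "card (rooted_tree.forward_neighbors (list_tree c) [] x) = c (length x)"
proof -
  interpret rooted_tree "list_tree c" "[]" by (rule lt_rooted)
  have "forward_neighbors x = (\<lambda>a. a # x) ` {..<c (length x)}"
    unfolding forward_neighbors_def
    using assms by (auto simp: lt_gdist_eq_1[unfolded One_nat_def] gdist_list_tree)
  then show ?thesis by (simp add: card_image inj_on_def)
qed

theorem Gamma_exists:
  assumes "k \<ge> 2" "\<gamma> \<ge> 1"
  shows "\<exists>(G :: nat list pair_pre_digraph) rt. Gamma_tree k \<gamma> G rt"
proof -
  define c where "c n = (if n = 0 \<or> n \<in> branching_radii \<gamma> then k else 1)" for n
  interpret rooted_tree "list_tree c" "[]" by (rule lt_rooted)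
  have v: "lt_valid c x" if "x \<in> pverts (list_tree c)" for x using that by simp
  have "Gamma_tree k \<gamma> (list_tree c) []"
  proof (intro Gamma_tree.intro Gamma_tree_axioms.intro)
    show "rooted_tree (list_tree c) []" by (rule lt_rooted)
  next
    fix x assume x: "x \<in> pverts (list_tree c)"
    note facts = lt_card_forward_neighbors[OF v[OF x]] gdist_list_tree[OF v[OF x]]
    show "card (forward_neighbors x) = k" if "x = [] \<or> gdist x [] \<in> branching_radii \<gamma>"
      using that unfolding facts c_def by auto
    show "card (forward_neighbors x) = 1" if "\<not> (x = [] \<or> gdist x [] \<in> branching_radii \<gamma>)"
      using that unfolding facts c_def by auto
  qed (use assms in auto)
  then show ?thesis by blast
qed

end

(* In a rooted tree every vertex other than the root has a unique neighbor closer to the root, so the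
   sphere of radius n + 1 is the disjoint union of the forward neighbors of the vertices in the sphere
   of radius n. Its cardinality therefore grows by the factor k exactly at the radii s_0 = 0 and
   s_N = [\<gamma>^1] + ... + [\<gamma>^N], and the spheres of radius n with s_{N-1} < n <= s_N have k^N elements.
   If s_N <= r < s_{N+1}, then r is comparable to \<gamma>^N and #B(r) to (\<gamma> k)^N, the lower bound coming
   from the s_N - s_{N-1} outermost spheres within radius s_N. Hence ln #B(r) differs from
   ln (\<gamma> k) / ln \<gamma> * ln r by a bounded amount. *)
theory Submission
  imports Defs
begin

section \<open>Walks, simple paths and the graph distance\<close>

lemma (in wf_digraph) awalk_imp_apath_le:
  assumes "awalk u p v"
  shows "\<exists>q. apath u q v \<and> length q \<le> length p"
  using assms
proof (induct rule: awalk_to_apath_induct)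
  case (path p)
  then show ?case by (auto simp: apath_def)
next
  case (decomp p q r s)
  have "length (q @ s) \<le> length p"
    using decomp by (auto elim!: awalk_cyc_decompE)
  with decomp show ?case using le_trans by blast
qed

text \<open>\<open>gdist\<close> minimises over simple paths only; cutting the cycles out of a walk
  never lengthens it, so arbitrary walks bound the distance too.\<close>

lemma (in wf_digraph) gdist_le:
  assumes "awalk u p v"
  shows "gdist u v \<le> length p"
proof -
  obtain q where q: "apath u q v" "length q \<le> length p"
    using awalk_imp_apath_le[OF assms] by blast
  have "gdist u v \<le> length q"
    unfolding gdist_def using q(1) by (intro Least_le) blast
  with q(2) show ?thesis by simp
qed

lemma (in wf_digraph) ex_apath_length_gdist:
  assumes "u \<rightarrow>\<^sup>* v"
  shows "\<exists>p. apath u p v \<and> length p = gdist u v"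
proof -
  have "\<exists>n p. apath u p v \<and> length p = n"
    using assms reachable_apath by blast
  then show ?thesis unfolding gdist_def by (rule LeastI_ex)
qed

lemma (in wf_digraph) gdist_self: "u \<in> verts G \<Longrightarrow> gdist u u = 0"
  using gdist_le[of u "[]" u] by (simp add: awalk_Nil_iff)

lemma pawalk_verts_snoc: "pcas u p v \<Longrightarrow> pawalk_verts u (p @ [(v, w)]) = pawalk_verts u p @ [w]"
  by (induction u p v rule: pcas.induct) auto

section \<open>Spheres and parents in a rooted tree\<close>

context rooted_tree
begin

text \<open>Connectedness refers to the symmetric closure; the arcs are symmetric already, so
  reachability in \<open>G\<close> is the same.\<close>

lemma reachable_verts:
  assumes "u \<in> pverts G" "v \<in> pverts G"
  shows "u \<rightarrow>\<^sup>*\<^bsub>with_proj G\<^esub> v"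
  using connected assms reachable_mk_symmetric_eq[OF sym_arcs]
  unfolding Digraph_Component.connected_def strongly_connected_def by simp

lemma ex_geodesic:
  assumes "u \<in> pverts G" "v \<in> pverts G"
  shows "\<exists>p. apath u p v \<and> length p = gdist u v"
  using ex_apath_length_gdist[OF reachable_verts[OF assms]] .

lemma gdist_eq_0_iff:
  assumes "u \<in> pverts G" "v \<in> pverts G"
  shows "gdist u v = 0 \<longleftrightarrow> u = v"
  using ex_geodesic[OF assms] gdist_self assms
  by (auto simp: apath_def awalk_Nil_iff)

lemma gdist_eq_1_iff:
  assumes "u \<in> pverts G" "v \<in> pverts G"
  shows "gdist u v = 1 \<longleftrightarrow> (u, v) \<in> parcs G"
proof
  assume "gdist u v = 1"
  then obtain p where "apath u p v" "length p = 1" using ex_geodesic[OF assms] by auto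
  then show "(u, v) \<in> parcs G"
    by (cases p) (auto simp: apath_def awalk_def)
next
  assume e: "(u, v) \<in> parcs G"
  then have "awalk u [(u, v)] v" using assms by (auto simp: awalk_def)
  from gdist_le[OF this] have "gdist u v \<le> 1" by simp
  moreover have "u \<noteq> v" using e no_loops' by blast
  ultimately show "gdist u v = 1" using gdist_eq_0_iff[OF assms] by linarith
qed

lemma gdist_arc_le:
  assumes "(u, v) \<in> parcs G" "w \<in> pverts G"
  shows "gdist u w \<le> Suc (gdist v w)"
proof -
  obtain p where "apath v p w" "length p = gdist v w"
    using ex_geodesic[of v w] assms in_arcsD2 by blast
  moreover from this have "awalk u ((u, v) # p) w"
    using assms in_arcsD1 by (auto simp: apath_def awalk_def)
  ultimately show ?thesis using gdist_le[of u "(u, v) # p" w] by simp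
qed

text \<open>The first arc of a geodesic works: the rest of it bounds the new distance by n, and one
  arc cannot lower the distance by more than 1.\<close>

lemma ex_arc_gdist_Suc:
  assumes "u \<in> pverts G" "w \<in> pverts G" "gdist u w = Suc n"
  shows "\<exists>v. (u, v) \<in> parcs G \<and> gdist v w = n"
proof -
  obtain p where p: "awalk u p w" "length p = Suc n"
    using ex_geodesic[OF assms(1,2)] assms(3) by (auto simp: apath_def)
  then obtain e q where "p = e # q" "length q = n" by (cases p) auto
  with p have e: "(u, snd e) \<in> parcs G" "awalk (snd e) q w"
    by (auto simp: awalk_Cons_iff)
  have "gdist (snd e) w \<le> n" using gdist_le[OF e(2)] \<open>length q = n\<close> by simp
  moreover have "Suc n \<le> Suc (gdist (snd e) w)"
    using gdist_arc_le[OF e(1) assms(2)] assms(3) by simp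
  ultimately show ?thesis using e(1) by auto
qed

definition sphere :: "nat \<Rightarrow> 'a set" where
  "sphere n = {x \<in> pverts G. gdist x rt = n}"

lemma sphere_0: "sphere 0 = {rt}"
  using gdist_eq_0_iff root_in_verts by (auto simp: sphere_def)

text \<open>Along an arc the distance to the root changes by at most 1, so a neighbor farther away
  lies exactly one level up.\<close>

lemma forward_neighbors_eq:
  assumes "x \<in> sphere n"
  shows "forward_neighbors x = {y \<in> sphere (Suc n). (x, y) \<in> parcs G}"
proof -
  have x: "x \<in> pverts G" "gdist x rt = n" using assms by (auto simp: sphere_def)
  have "gdist y rt \<le> Suc n" if "(x, y) \<in> parcs G" for y
    using gdist_arc_le[of y x rt] that root_in_verts x arcs_symmetric by auto
  then show ?thesis
    using x gdist_eq_1_iff[OF x(1)]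
    unfolding forward_neighbors_def sphere_def by (auto intro: le_antisym)
qed

text \<open>Descend one level from both ends and join the two lower vertices by induction. The
  joining path stays at distance at most n, so it avoids the ends at distance n + 1 and the extended
  path is again simple.\<close>

lemma ex_apath_below_sphere:
  assumes "x \<in> sphere n" "y \<in> sphere n"
  shows "\<exists>p. apath x p y \<and> (\<forall>v \<in> set (pawalk_verts x p). gdist v rt \<le> n)"
  using assms
proof (induction n arbitrary: x y)
  case 0
  then show ?case using root_in_verts
    by (intro exI[of _ "[]"]) (auto simp: sphere_0 apath_Nil_iff gdist_self)
next
  case (Suc n)
  note xy = Suc.prems
  show ?case
  proof (cases "x = y")
    case True
    then show ?thesis using xy
      by (intro exI[of _ "[]"]) (auto simp: apath_Nil_iff sphere_def)
  next
    case False
    obtain x' where x': "(x, x') \<in> parcs G" "x' \<in> sphere n"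
      using ex_arc_gdist_Suc[of x rt n] xy root_in_verts in_arcsD2
      by (auto simp: sphere_def)
    obtain y' where y': "(y, y') \<in> parcs G" "y' \<in> sphere n"
      using ex_arc_gdist_Suc[of y rt n] xy root_in_verts in_arcsD2
      by (auto simp: sphere_def)
    obtain p where p: "apath x' p y'" "\<forall>v \<in> set (pawalk_verts x' p). gdist v rt \<le> n"
      using Suc.IH[OF x'(2) y'(2)] by blast
    have "x \<notin> set (pawalk_verts x' p)" "y \<notin> set (pawalk_verts x' p)"
      using p(2) xy by (auto simp: sphere_def)
    moreover have "(y', y) \<in> parcs G" using y'(1) arcs_symmetric by blast
    ultimately have "apath x ((x, x') # p @ [(y', y)]) y"
      using p(1) x' xy False
      by (auto simp: apath_def awalk_Cons_iff awalk_Nil_iff pawalk_verts_snoc awalk_def sphere_def)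
    moreover have "set (pawalk_verts x ((x, x') # p @ [(y', y)])) = insert x (insert y (set (pawalk_verts x' p)))"
      using p(1) by (auto simp: apath_def awalk_def pawalk_verts_snoc)
    ultimately show ?thesis using p(2) xy by (fastforce simp: sphere_def intro: le_SucI)
  qed
qed

text \<open>Two parents of \<open>y\<close> are joined by a path that stays closer to the root than \<open>y\<close>, and \<open>y\<close>
  closes it to a cycle.\<close>

lemma unique_parent:
  assumes "x \<in> sphere n" "x' \<in> sphere n" "y \<in> sphere (Suc n)"
    and "(x, y) \<in> parcs G" "(x', y) \<in> parcs G"
  shows "x = x'"
proof (rule ccontr)
  assume ne: "x \<noteq> x'"
  obtain p where p: "apath x p x'" "\<forall>v \<in> set (pawalk_verts x p). gdist v rt \<le> n"
    using ex_apath_below_sphere[OF assms(1,2)] by blast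
  \<comment> \<open>A nonempty \<open>p\<close> gives the closed walk through y length at least 3,
    as \<open>acyclic\<close> requires.\<close>
  then have "p \<noteq> []" using ne by (auto simp: apath_Nil_iff)
  have "y \<notin> set (pawalk_verts x p)" using p(2) assms(3) by (auto simp: sphere_def)
  moreover have "(y, x) \<in> parcs G" using assms(4) arcs_symmetric by blast
  ultimately have "cycle ((y, x) # p @ [(x', y)])"
    using p(1) assms unfolding cycle_def
    by (intro exI[of _ y])
      (auto simp: apath_def pawalk_verts_snoc awalk_def sphere_def)
  moreover have "length ((y, x) # p @ [(x', y)]) \<ge> 3"
    using \<open>p \<noteq> []\<close> by (cases p) auto
  ultimately show False using acyclic by blast
qed

lemma sphere_Suc: "sphere (Suc n) = (\<Union>x \<in> sphere n. forward_neighbors x)"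
proof -
  have "\<exists>x \<in> sphere n. (x, y) \<in> parcs G" if "y \<in> sphere (Suc n)" for y
    using ex_arc_gdist_Suc[of y rt n] that root_in_verts in_arcsD2 arcs_symmetric
    unfolding sphere_def by blast
  then show ?thesis by (auto simp: forward_neighbors_eq)
qed

lemma forward_neighbors_disjoint:
  assumes "x \<in> sphere n" "x' \<in> sphere n" "x \<noteq> x'"
  shows "forward_neighbors x \<inter> forward_neighbors x' = {}"
  using assms unique_parent by (auto simp: forward_neighbors_eq)

text \<open>For r < 0 the ball is empty, whereas \<open>nat\<close> truncates the floor to 0 and the
  union would still contain the root.\<close>

lemma gball_eq: "r \<ge> 0 \<Longrightarrow> gball rt r = (\<Union>n \<le> nat \<lfloor>r\<rfloor>. sphere n)"
  by (auto simp: gball_def sphere_def le_nat_floor nat_le_iff le_floor_iff le_nat_iff)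

lemma card_sphere_Suc:
  assumes "\<And>x. x \<in> sphere n \<Longrightarrow> card (forward_neighbors x) = c" "finite (sphere n)" "c > 0"
  shows "finite (sphere (Suc n)) \<and> card (sphere (Suc n)) = card (sphere n) * c"
proof -
  \<comment> \<open>\<open>card\<close> is 0 on infinite sets, so c > 0 forces finiteness.\<close>
  have fin: "finite (forward_neighbors x)" if "x \<in> sphere n" for x
    using assms(1)[OF that] assms(3) card.infinite by fastforce
  then have "card (sphere (Suc n)) = (\<Sum>x\<in>sphere n. card (forward_neighbors x))"
    unfolding sphere_Suc using assms(2) forward_neighbors_disjoint
    by (intro card_UN_disjoint) auto
  then show ?thesis using fin assms by (simp add: sphere_Suc)
qed

end

section \<open>Sphere and ball cardinalities as products and sums\<close>

context Gamma_tree
begin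

text \<open>Only the root lies at level 0, so the number of forward neighbors depends on the level
  alone, and each level passed contributes one factor.\<close>

lemma card_sphere_Gamma:
  "finite (sphere n) \<and> card (sphere n) = (\<Prod>i<n. if i = 0 \<or> i \<in> branching_radii \<gamma> then k else 1)"
proof (induction n)
  case 0
  then show ?case by (simp add: sphere_0)
next
  case (Suc n)
  have "card (forward_neighbors x) = (if n = 0 \<or> n \<in> branching_radii \<gamma> then k else 1)"
    if x: "x \<in> sphere n" for x
  proof -
    have "x \<in> pverts G" "gdist x rt = n" "x = rt \<longleftrightarrow> n = 0"
      using x gdist_eq_0_iff[of x rt] root_in_verts by (auto simp: sphere_def)
    then show ?thesis
      using card_forward_neighbors_branching card_forward_neighbors_other by auto
  qed
  from card_sphere_Suc[OF this] Suc k_ge_2 show ?case by auto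
qed

lemma card_gball:
  assumes "r \<ge> 0"
  shows "card (gball rt r) = (\<Sum>n\<le>nat \<lfloor>r\<rfloor>. card (sphere n))"
  unfolding gball_eq[OF assms]
  using card_sphere_Gamma by (intro card_UN_disjoint) (auto simp: sphere_def)

end

section \<open>Auxiliary facts on products and limits\<close>

text \<open>The values of s below n are exactly s 0, ..., s N, which gives N + 1 factors k.\<close>

lemma prod_if_range_strict_mono:
  fixes s :: "nat \<Rightarrow> nat" and k :: "'a::comm_semiring_1"
  assumes "strict_mono s" "s N < n" "n \<le> s (Suc N)"
  shows "(\<Prod>i<n. if i \<in> range s then k else 1) = k ^ Suc N"
proof -
  have "s i < n \<longleftrightarrow> i \<le> N" for i
  proof
    assume "s i < n"
    then have "s i < s (Suc N)" using assms(3) by simp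
    then show "i \<le> N" using strict_mono_less[OF assms(1)] by simp
  next
    assume "i \<le> N"
    then have "s i \<le> s N" using strict_mono_less_eq[OF assms(1)] by simp
    then show "s i < n" using assms(2) by simp
  qed
  then have "{i \<in> {..<n}. i \<in> range s} = s ` {..N}" by auto
  then have "(\<Prod>i<n. if i \<in> range s then k else 1) = (\<Prod>i\<in>s ` {..N}. k)"
    by (subst prod.inter_filter[symmetric]) auto
  also have "\<dots> = k ^ Suc N"
    using strict_mono_imp_inj_on[OF assms(1)] by (simp add: card_image inj_on_subset)
  finally show ?thesis .
qed

text \<open>The error f / g - c equals (f - c g) / g, which is dominated by K / g.\<close>

lemma tendsto_divide_of_bounded_diff:
  fixes f g :: "'a \<Rightarrow> real"
  assumes bnd: "\<forall>\<^sub>F x in F. \<bar>f x - c * g x\<bar> \<le> K" and g: "filterlim g at_top F"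
  shows "((\<lambda>x. f x / g x) \<longlongrightarrow> c) F"
proof -
  have "((\<lambda>x. K / g x) \<longlongrightarrow> 0) F"
    using g by (intro tendsto_divide_0[OF tendsto_const] filterlim_at_top_imp_at_infinity)
  moreover have "\<forall>\<^sub>F x in F. norm (f x / g x - c) \<le> norm (K / g x) * 1"
    using bnd filterlim_at_top_dense[THEN iffD1, OF g, rule_format, of 0]
  proof eventually_elim
    case (elim x)
    then have "f x / g x - c = (f x - c * g x) / g x" by (simp add: field_simps)
    then show ?case using elim by (auto simp: abs_divide intro!: divide_right_mono)
  qed
  ultimately have "((\<lambda>x. f x / g x - c) \<longlongrightarrow> 0) F"
    by (rule tendsto_0_le)
  then show ?thesis by (simp add: LIM_zero_iff)
qed

section \<open>Growth of the branching radii\<close>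

definition branching_radius :: "real \<Rightarrow> nat \<Rightarrow> nat" where
  "branching_radius \<gamma> N = (\<Sum>j=1..N. nat \<lfloor>\<gamma> ^ j\<rfloor>)"

lemma branching_radius_0 [simp]: "branching_radius \<gamma> 0 = 0"
  by (simp add: branching_radius_def)

lemma branching_radius_Suc:
  "branching_radius \<gamma> (Suc N) = branching_radius \<gamma> N + nat \<lfloor>\<gamma> ^ Suc N\<rfloor>"
  by (simp add: branching_radius_def)

text \<open>Index 0 accounts for the root, so a single sequence enumerates all branching
  levels.\<close>

lemma range_branching_radius: "range (branching_radius \<gamma>) = insert 0 (branching_radii \<gamma>)"
proof -
  have "branching_radii \<gamma> = branching_radius \<gamma> ` {1..}"
    by (auto simp: branching_radii_def branching_radius_def)
  moreover have "(UNIV :: nat set) = insert 0 {1..}" by auto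
  ultimately show ?thesis by (metis branching_radius_0 image_insert)
qed

lemma strict_mono_branching_radius: "\<gamma> \<ge> 1 \<Longrightarrow> strict_mono (branching_radius \<gamma>)"
  using one_le_power[of \<gamma> "Suc _"] unfolding strict_mono_Suc_iff branching_radius_Suc
  by (smt (verit) less_add_same_cancel1 one_le_floor zero_less_nat_eq)

text \<open>For x \<ge> 1 the integer part satisfies [x] \<ge> 1 and x < [x] + 1 \<le> 2
  [x].\<close>

lemma branching_radius_step_ge:
  assumes "\<gamma> \<ge> 1"
  shows "\<gamma> ^ Suc N / 2 \<le> real (branching_radius \<gamma> (Suc N)) - real (branching_radius \<gamma> N)"
proof -
  have 1: "\<gamma> ^ Suc N \<ge> 1" using assms by (rule one_le_power)
  then have "\<lfloor>\<gamma> ^ Suc N\<rfloor> \<ge> 1" by (simp only: one_le_floor)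
  then have "\<gamma> ^ Suc N / 2 \<le> \<lfloor>\<gamma> ^ Suc N\<rfloor>" by linarith
  then show ?thesis using 1 by (simp add: branching_radius_Suc del: power_Suc)
qed

text \<open>Geometric sum: C = \<gamma> / (\<gamma> - 1) solves C + \<gamma> = C \<gamma>, which
  makes the induction step an equality after the floor is dropped.\<close>

lemma branching_radius_le:
  assumes "\<gamma> > 1"
  shows "real (branching_radius \<gamma> N) \<le> \<gamma> / (\<gamma> - 1) * \<gamma> ^ N"
proof (induction N)
  case 0
  then show ?case using assms by simp
next
  case (Suc N)
  have "real (nat \<lfloor>\<gamma> ^ Suc N\<rfloor>) \<le> \<gamma> ^ Suc N" using assms by (simp del: power_Suc)
  with Suc have "real (branching_radius \<gamma> (Suc N)) \<le> \<gamma> / (\<gamma> - 1) * \<gamma> ^ N + \<gamma> ^ Suc N"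
    by (simp add: branching_radius_Suc del: power_Suc)
  also have "\<dots> = \<gamma> / (\<gamma> - 1) * \<gamma> ^ Suc N" using assms by (simp add: field_simps)
  finally show ?case .
qed

section \<open>Two-sided estimates for the balls\<close>

context Gamma_tree
begin

lemma card_sphere_between:
  assumes "branching_radius \<gamma> N < n" "n \<le> branching_radius \<gamma> (Suc N)"
  shows "card (sphere n) = k ^ Suc N"
  using card_sphere_Gamma prod_if_range_strict_mono[OF strict_mono_branching_radius[OF \<gamma>_ge_1] assms]
  by (simp add: range_branching_radius)

lemma card_sphere_mono:
  assumes "m \<le> n"
  shows "card (sphere m) \<le> card (sphere n)"
  using k_ge_2 by (intro lift_Suc_mono_le[OF _ assms]) (simp add: card_sphere_Gamma)

lemma card_gball_le:
  assumes "branching_radius \<gamma> N \<le> nat \<lfloor>r\<rfloor>" "nat \<lfloor>r\<rfloor> < branching_radius \<gamma> (Suc N)" "r \<ge> 0"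
  shows "card (gball rt r) \<le> branching_radius \<gamma> (Suc N) * k ^ Suc N"
proof -
  have "card (sphere n) \<le> k ^ Suc N" if "n \<le> nat \<lfloor>r\<rfloor>" for n
    using card_sphere_mono[of n "branching_radius \<gamma> (Suc N)"] card_sphere_between[of N] assms that
    by simp
  then have "card (gball rt r) \<le> (\<Sum>n\<le>nat \<lfloor>r\<rfloor>. k ^ Suc N)"
    unfolding card_gball[OF assms(3)] by (intro sum_mono) auto
  also have "\<dots> = Suc (nat \<lfloor>r\<rfloor>) * k ^ Suc N" by simp
  \<comment> \<open>The strict bound on the floor of r absorbs the extra sphere of radius 0.\<close>
  also have "\<dots> \<le> branching_radius \<gamma> (Suc N) * k ^ Suc N"
    using assms(2) by (intro mult_right_mono) auto
  finally show ?thesis .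
qed

lemma card_gball_ge:
  assumes "branching_radius \<gamma> (Suc N) \<le> nat \<lfloor>r\<rfloor>" "r \<ge> 0"
  shows "(branching_radius \<gamma> (Suc N) - branching_radius \<gamma> N) * k ^ Suc N \<le> card (gball rt r)"
proof -
  have "(branching_radius \<gamma> (Suc N) - branching_radius \<gamma> N) * k ^ Suc N
      = (\<Sum>n \<in> {branching_radius \<gamma> N<..branching_radius \<gamma> (Suc N)}. card (sphere n))"
    by (simp add: card_sphere_between[of N] cong: sum.cong_simp)
  also have "\<dots> \<le> (\<Sum>n\<le>nat \<lfloor>r\<rfloor>. card (sphere n))"
    using assms(1) by (intro sum_mono2) auto
  finally show ?thesis by (simp add: card_gball[OF assms(2)])
qed

text \<open>Both r and the ball size lie within constant factors of \<gamma>^N and (\<gamma> k)^N.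
  As c ln \<gamma> = ln (\<gamma> k), the terms in N cancel after taking logarithms.\<close>

lemma ln_card_gball_bounded_diff:
  assumes gt1: "\<gamma> > 1" and r: "r \<ge> \<gamma>"
  defines "c \<equiv> ln (\<gamma> * k) / ln \<gamma>" and "C \<equiv> \<gamma> / (\<gamma> - 1)"
  shows "\<bar>ln (card (gball rt r)) - c * ln r\<bar> \<le> (1 + c) * (ln C + ln 2) + ln (\<gamma> * k)"
proof -
  let ?s = "branching_radius \<gamma>" and ?m = "nat \<lfloor>r\<rfloor>" and ?B = "real (card (gball rt r))"
  \<comment> \<open>From r \<ge> \<gamma> follows N \<ge> 1 below, so that a predecessor M exists
    and the outermost complete block of spheres can be counted.\<close>
  have m: "?s 1 \<le> ?m" using r by (simp add: branching_radius_def nat_mono floor_mono)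
  \<comment> \<open>A strictly increasing sequence of naturals dominates its index, so the minimum
    defining N exists.\<close>
  have ex: "?m < ?s (Suc ?m)"
    using strict_mono_imp_increasing[OF strict_mono_branching_radius[OF \<gamma>_ge_1], of "Suc ?m"] by simp
  define N where "N = (LEAST N. ?m < ?s (Suc N))"
  have upper: "?m < ?s (Suc N)" unfolding N_def using ex by (rule LeastI)
  have "N \<noteq> 0" using upper m by (intro notI) simp
  then obtain M where M: "N = Suc M" by (cases N) auto
  then have lower: "?s N \<le> ?m" using not_less_Least[of M "\<lambda>N. ?m < ?s (Suc N)"] N_def by simp
  have pos: "\<gamma> > 0" "r > 0" "real k > 0" "C > 1" using gt1 r k_ge_2 by (auto simp: C_def field_simps)
  have lnpos: "ln \<gamma> > 0" "ln C > 0" "ln (\<gamma> * k) > 0"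
    using gt1 pos k_ge_2 by (auto intro!: ln_gt_zero less_1_mult)
  then have c: "c > 0" "c * ln \<gamma> = ln (\<gamma> * k)" by (auto simp: c_def)

  have step: "\<gamma> ^ N / 2 \<le> real (?s N) - real (?s M)"
    using branching_radius_step_ge[OF \<gamma>_ge_1] M by simp
  have r_lo: "\<gamma> ^ N / 2 \<le> r"
  proof -
    have "real (?s N) \<le> r" using lower pos by linarith
    then show ?thesis using step by simp
  qed
  have r_hi: "r \<le> C * \<gamma> ^ Suc N"
  proof -
    have "r \<le> real (?s (Suc N))" using upper pos by linarith
    then show ?thesis using branching_radius_le[OF gt1, of "Suc N"] by (simp add: C_def)
  qed
  have B_lo: "(\<gamma> * k) ^ N / 2 \<le> ?B"
  proof -
    have "(\<gamma> * k) ^ N / 2 = \<gamma> ^ N / 2 * k ^ N" by (simp add: power_mult_distrib)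
    also have "\<dots> \<le> (real (?s N) - real (?s M)) * k ^ N"
      by (rule mult_right_mono[OF step]) simp
    also have "\<dots> = real ((?s N - ?s M) * k ^ N)" by (simp add: M branching_radius_Suc)
    also have "\<dots> \<le> ?B" using card_gball_ge[of M r] lower pos M by (simp only: of_nat_le_iff)
    finally show ?thesis .
  qed
  have B_hi: "?B \<le> C * (\<gamma> * k) ^ Suc N"
  proof -
    have "?B \<le> real (?s (Suc N) * k ^ Suc N)"
      using card_gball_le[OF lower upper] pos by (simp only: of_nat_le_iff)
    also have "\<dots> = real (?s (Suc N)) * k ^ Suc N" by simp
    also have "\<dots> \<le> C * \<gamma> ^ Suc N * k ^ Suc N"
      using branching_radius_le[OF gt1] unfolding C_def by (rule mult_right_mono) simp
    finally show ?thesis by (simp only: power_mult_distrib mult.assoc of_nat_power)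
  qed
  have Bpos: "?B > 0" using B_lo pos by (smt (verit) divide_pos_pos mult_pos_pos zero_less_power)

  have "ln (\<gamma> ^ N / 2) \<le> ln r" using r_lo pos by (subst ln_le_cancel_iff) auto
  then have 1: "N * ln \<gamma> - ln 2 \<le> ln r" using pos by (simp add: ln_div ln_realpow)
  have "ln r \<le> ln (C * \<gamma> ^ Suc N)" using r_hi pos by (subst ln_le_cancel_iff) auto
  then have 2: "ln r \<le> ln C + Suc N * ln \<gamma>" using pos by (simp add: ln_mult ln_realpow del: power_Suc)
  have "ln ((\<gamma> * k) ^ N / 2) \<le> ln ?B" using B_lo pos Bpos by (subst ln_le_cancel_iff) auto
  then have 3: "N * ln (\<gamma> * k) - ln 2 \<le> ln ?B" using pos by (simp add: ln_div ln_realpow)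
  have "ln ?B \<le> ln (C * (\<gamma> * k) ^ Suc N)" using B_hi pos Bpos by (subst ln_le_cancel_iff) auto
  moreover have "ln (C * (\<gamma> * k) ^ Suc N) = ln C + Suc N * ln (\<gamma> * k)"
    using pos by (subst ln_mult) (auto simp: ln_realpow simp del: power_Suc)
  ultimately have 4: "ln ?B \<le> ln C + Suc N * ln (\<gamma> * k)" by simp
  \<comment> \<open>Scaling by c turns multiples of ln \<gamma> into multiples of ln (\<gamma> k),
    ready to cancel against 3 and 4.\<close>
  have "c * (N * ln \<gamma> - ln 2) \<le> c * ln r" using 1 c by simp
  then have 5: "N * ln (\<gamma> * k) - c * ln 2 \<le> c * ln r"
    unfolding c(2)[symmetric] by (simp add: algebra_simps)
  have "c * ln r \<le> c * (ln C + Suc N * ln \<gamma>)" using 2 c by simp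
  then have 6: "c * ln r \<le> c * ln C + Suc N * ln (\<gamma> * k)"
    unfolding c(2)[symmetric] by (simp add: algebra_simps)
  \<comment> \<open>The one-sided bounds are ln C + c ln 2 + ln (\<gamma> k) and c ln C + ln 2 + ln
    (\<gamma> k); positivity of the missing terms puts both under the stated constant.\<close>
  have "c * ln 2 > 0" "c * ln C > 0" "ln 2 > (0::real)" using c lnpos by auto
  then show ?thesis using 3 4 5 6 lnpos
    unfolding abs_le_iff of_nat_Suc distrib_left distrib_right by linarith
qed

end

theorem proposition1p1:
  fixes k :: nat and \<gamma> :: real and G :: "'a pair_pre_digraph" and rt :: 'a
  assumes "k \<ge> 2" and "\<gamma> > 1" and "Gamma_tree k \<gamma> G rt"
  shows "((\<lambda>r::real. ln (real (card (pre_digraph.gball (with_proj G) rt r))) / ln r)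
           \<longlongrightarrow> ln (\<gamma> * real k) / ln \<gamma>) at_top
         \<and> ln (\<gamma> * real k) / ln \<gamma> = 1 + ln (real k) / ln \<gamma>"
proof
  interpret Gamma_tree k \<gamma> G rt by fact
  \<comment> \<open>The bounded difference holds for all r \<ge> \<gamma>, hence eventually, and ln
    r tends to infinity.\<close>
  show "((\<lambda>r::real. ln (real (card (gball rt r))) / ln r) \<longlongrightarrow> ln (\<gamma> * real k) / ln \<gamma>) at_top"
    by (rule tendsto_divide_of_bounded_diff[OF _ ln_at_top])
      (use ln_card_gball_bounded_diff[OF assms(2)] in \<open>auto intro: eventually_at_top_linorderI\<close>)
  show "ln (\<gamma> * real k) / ln \<gamma> = 1 + ln (real k) / ln \<gamma>"
    using assms by (simp add: ln_mult add_divide_distrib)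
qed

end
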